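(* Let $a\in\mathbb R$, $a\neq0$, and $$W(x)=e^{-x^2}\begin{pmatrix}1+a^2x^2&ax\\ ax&1\end{pmatrix},\qquad x\in\mathbb R.$$ The algebra $\mathcal D(W)$ is generated by $\{I,D_1,D_5\}$, where $$D_1=\partial^2\begin{pmatrix}-ax&a^2x^2-1\\ -1&ax\end{pmatrix}+\partial\begin{pmatrix}-2a&2a^2x+4x\\ 0&0\end{pmatrix}+\begin{pmatrix}0&2+\frac4{a^2}\\ \frac4{a^2}&0\end{pmatrix},$$ $$D_5=\partial^2I+\partial\begin{pmatrix}-2x&2a\\ 0&-2x\end{pmatrix}+\begin{pmatrix}-2-\frac4{a^2}&0\\ 0&-\frac4{a^2}\end{pmatrix}.$$
   Context: For a weight matrix $W$ of size $N$ on an interval $(x_0,x_1)$ put $\langle P,Q\rangle_W=\int_{x_0}^{x_1}P(x)W(x)Q(x)^*\,dx$ for $P,Q\in\operatorname{Mat}_N(\mathbb C[x])$. The monic orthogonal polynomials of $W$ are the unique $P_n\in\operatorname{Mat}_N(\mathbb C[x])$, $n\ge0$, of degree $n$ with leading coefficient $I$ and $\langle P_n,P_m\rangle_W=0$ for $n\ne m$. Differential operators $D=\sum_{i=0}^s\partial^iF_i(x)$, $\partial=d/dx$, act on the right on matrix functions: $P\cdot D=\sum_i P^{(i)}F_i$, and products satisfy $P\cdot(DE)=(P\cdot D)\cdot E$. $\operatorname{Mat}_N(\Omega[x])$ is the algebra of such operators with coefficients $F_i\in\operatorname{Mat}_N(\mathbb C[x])$. $$\mathcal D(W)=\{D\in\operatorname{Mat}_N(\Omega[x]):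 P_n\cdot D=\Lambda_n(D)P_n\text{ for some }\Lambda_n(D)\in\operatorname{Mat}_N(\mathbb C),\ \forall n\ge0\}.$$ "Generated" means generated as an algebra over $\mathbb C$. *)

theory Defs
  imports "HOL-Analysis.Analysis" "HOL-Computational_Algebra.Polynomial"
begin

subsection \<open>Matrix polynomials\<close>

type_synonym 'n matpoly = "complex poly ^ 'n ^ 'n"

definition mp_const :: "complex ^ 'n ^ 'n \<Rightarrow> 'n matpoly" where
  "mp_const A = (\<chi> i j. [:A $ i $ j:])"

definition mp_coeff :: "'n::finite matpoly \<Rightarrow> nat \<Rightarrow> complex ^ 'n ^ 'n" where
  "mp_coeff P k = (\<chi> i j. coeff (P $ i $ j) k)"

definition mp_eval :: "'n::finite matpoly \<Rightarrow> real \<Rightarrow> complex ^ 'n ^ 'n" where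
  "mp_eval P x = (\<chi> i j. poly (P $ i $ j) (complex_of_real x))"

definition mp_deriv :: "'n::finite matpoly \<Rightarrow> 'n matpoly" where
  "mp_deriv P = (\<chi> i j. pderiv (P $ i $ j))"

definition mp_monic :: "nat \<Rightarrow> 'n::finite matpoly \<Rightarrow> bool" where
  "mp_monic n P \<longleftrightarrow> mp_coeff P n = mat 1 \<and> (\<forall>k>n. mp_coeff P k = 0)"

subsection \<open>Orthogonal polynomials of a weight matrix\<close>

definition ctranspose :: "complex ^ 'n ^ 'm \<Rightarrow> complex ^ 'm ^ 'n" where
  "ctranspose A = (\<chi> i j. cnj (A $ j $ i))"

text \<open>The integral of a matrix function over the interval \<open>S\<close> is taken entrywise.\<close>

definition mp_inner ::
  "real set \<Rightarrow> (real \<Rightarrow> complex ^ 'n ^ 'n) \<Rightarrow> 'n::finite matpoly \<Rightarrow> 'n matpoly \<Rightarrow> complex ^ 'n ^ 'n"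
where
  "mp_inner S W P Q =
     (\<chi> i j. LINT x:S|lborel. (mp_eval P x ** W x ** ctranspose (mp_eval Q x)) $ i $ j)"

definition is_monic_ortho ::
  "real set \<Rightarrow> (real \<Rightarrow> complex ^ 'n ^ 'n) \<Rightarrow> (nat \<Rightarrow> 'n::finite matpoly) \<Rightarrow> bool"
where
  "is_monic_ortho S W P \<longleftrightarrow>
     (\<forall>n. mp_monic n (P n)) \<and> (\<forall>n m. n \<noteq> m \<longrightarrow> mp_inner S W (P n) (P m) = 0)"

definition monic_ortho ::
  "real set \<Rightarrow> (real \<Rightarrow> complex ^ 'n ^ 'n) \<Rightarrow> nat \<Rightarrow> 'n::finite matpoly"
where
  "monic_ortho S W = (THE P. is_monic_ortho S W P)"

subsection \<open>Differential operators acting on the right\<close>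

text \<open>
  The operator \<open>\<Sum>i\<le>s. \<partial>^i F\<^sub>i\<close> is represented by the polynomial in the symbol \<open>\<partial>\<close> whose \<open>i\<close>-th
  coefficient is \<open>F\<^sub>i\<close>, so \<open>[:F\<^sub>0, F\<^sub>1, F\<^sub>2:]\<close> is \<open>\<partial>^2 F\<^sub>2 + \<partial> F\<^sub>1 + F\<^sub>0\<close>. Only the additive structure
  of the type \<open>poly\<close> is used; the product of operators is \<open>diffop_mult\<close> below.
\<close>

type_synonym 'n diffop = "(complex poly ^ 'n ^ 'n) poly"

definition diffop_act :: "'n::finite matpoly \<Rightarrow> 'n diffop \<Rightarrow> 'n matpoly" where
  "diffop_act P D = (\<Sum>i\<le>degree D. (mp_deriv ^^ i) P ** coeff D i)"

definition diffop_one :: "'n::finite diffop" where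
  "diffop_one = [:mat 1:]"

definition diffop_scale :: "complex \<Rightarrow> 'n::finite diffop \<Rightarrow> 'n diffop" where
  "diffop_scale c D = map_poly (\<lambda>F. mp_const (mat c) ** F) D"

text \<open>
  By the Leibniz rule, \<open>((P\<^sup>(\<^sup>i\<^sup>) F)\<^sup>(\<^sup>j\<^sup>)) G = (\<Sum>k\<le>j. (j choose k) P\<^sup>(\<^sup>i\<^sup>+\<^sup>k\<^sup>) F\<^sup>(\<^sup>j\<^sup>-\<^sup>k\<^sup>) G)\<close>; hence the
  product below. The lemma \<open>diffop_act_mult\<close> is the law \<open>P \<cdot> (D E) = (P \<cdot> D) \<cdot> E\<close>.
\<close>

definition diffop_mult :: "'n::finite diffop \<Rightarrow> 'n diffop \<Rightarrow> 'n diffop" where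
  "diffop_mult D E =
     (\<Sum>i\<le>degree D. \<Sum>j\<le>degree E. \<Sum>k\<le>j.
        monom (mat (of_nat (j choose k)) ** ((mp_deriv ^^ (j - k)) (coeff D i) ** coeff E j)) (i + k))"

lemma mp_deriv_add: "mp_deriv (P + Q) = mp_deriv P + mp_deriv Q"
  by (simp add: mp_deriv_def vec_eq_iff pderiv_add)

lemma mp_deriv_0 [simp]: "mp_deriv 0 = 0"
  by (simp add: mp_deriv_def vec_eq_iff)

lemma mp_deriv_pow_add: "(mp_deriv ^^ n) (P + Q) = (mp_deriv ^^ n) P + (mp_deriv ^^ n) Q"
  by (induction n) (simp_all add: mp_deriv_add)

lemma mp_deriv_pow_0 [simp]: "(mp_deriv ^^ n) 0 = 0"
  by (induction n) simp_all

lemma mp_deriv_pow_sum: "(mp_deriv ^^ n) (\<Sum>i\<in>A. f i) = (\<Sum>i\<in>A. (mp_deriv ^^ n) (f i))"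
  by (induction A rule: infinite_finite_induct) (simp_all add: mp_deriv_pow_add)

lemma mat_mult_entry: "((mat c ** A) :: 'a::comm_semiring_1 ^ 'n ^ 'm) $ i $ j = c * A $ i $ j"
  by (simp add: matrix_matrix_mult_def mat_def if_distribR if_distrib[of "\<lambda>x. x * _"] cong: if_cong)

lemma mat_scalar_commute:
  "(A ** (mat c ** B) :: 'a::comm_semiring_1 ^ 'n ^ 'n) = mat c ** (A ** B)"
proof -
  have "(A ** (mat c ** B)) $ i $ j = (mat c ** (A ** B)) $ i $ j" for i j
  proof -
    have "(A ** (mat c ** B)) $ i $ j = (\<Sum>k\<in>UNIV. A $ i $ k * (mat c ** B) $ k $ j)"
      by (simp add: matrix_matrix_mult_def)
    also have "\<dots> = c * (A ** B) $ i $ j"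
      unfolding mat_mult_entry
      by (simp add: matrix_matrix_mult_def sum_distrib_left mult.left_commute)
    finally show ?thesis
      by (simp add: mat_mult_entry)
  qed
  then show ?thesis
    by (simp add: vec_eq_iff)
qed

lemma matrix_mult_sum_left: "(\<Sum>i\<in>I. f i) ** A = (\<Sum>i\<in>I. f i ** (A :: 'a::comm_ring_1 ^ 'n ^ 'n))"
  by (induction I rule: infinite_finite_induct)
    (simp_all add: matrix_matrix_mult_def vec_eq_iff distrib_right sum.distrib)

lemma matrix_mult_0_right: "A ** (0 :: 'a::comm_ring_1 ^ 'n ^ 'n) = 0"
  by (simp add: matrix_matrix_mult_def vec_eq_iff)

lemma mp_deriv_mat_of_nat: "mp_deriv (mat (of_nat c) ** P) = mat (of_nat c) ** mp_deriv P"
proof -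
  have "mp_deriv (mat (of_nat c) ** P) $ i $ j = (mat (of_nat c) ** mp_deriv P) $ i $ j" for i j
    unfolding mat_mult_entry by (simp add: mp_deriv_def mat_mult_entry pderiv_mult)
  then show ?thesis
    by (simp add: vec_eq_iff)
qed

lemma mp_leibniz:
  "(mp_deriv ^^ n) (P ** Q) =
     (\<Sum>k\<le>n. mat (of_nat (n choose k)) ** ((mp_deriv ^^ k) P ** (mp_deriv ^^ (n - k)) Q))"
proof -
  have higher: "((mp_deriv ^^ n) P) $ i $ j = (pderiv ^^ n) (P $ i $ j)" for n i j and P :: "'a matpoly"
    by (induction n) (simp_all add: mp_deriv_def)
  have poly: "(pderiv ^^ n) (p * q) =
      (\<Sum>k\<le>n. of_nat (n choose k) * ((pderiv ^^ k) p * (pderiv ^^ (n - k)) q))"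
    for p q :: "complex poly"
  proof (induction n)
    case (Suc n)
    define T where "T k l = (pderiv ^^ k) p * (pderiv ^^ l) q" for k l
    have d: "pderiv (of_nat c * T k l) = of_nat c * T (Suc k) l + of_nat c * T k (Suc l)" for c k l
      by (simp add: T_def pderiv_mult algebra_simps)
    have "(pderiv ^^ Suc n) (p * q) = pderiv (\<Sum>k\<le>n. of_nat (n choose k) * T k (n - k))"
      using Suc by (simp add: T_def)
    also have "\<dots> = (\<Sum>k\<le>n. of_nat (n choose k) * T (Suc k) (n - k))
                  + (\<Sum>k\<le>n. of_nat (n choose k) * T k (Suc n - k))"
      by (simp add: higher_pderiv_sum[of 1, simplified] d sum.distrib Suc_diff_le)
    also have "(\<Sum>k\<le>n. of_nat (n choose k) * T k (Suc n - k))
             = (\<Sum>k\<le>Suc n. of_nat (n choose k) * T k (Suc n - k))"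
      by simp
    also have "\<dots> = T 0 (Suc n) + (\<Sum>k\<le>n. of_nat (n choose Suc k) * T (Suc k) (n - k))"
      by (subst sum.atMost_Suc_shift) simp
    also have "(\<Sum>k\<le>n. of_nat (n choose k) * T (Suc k) (n - k)) + \<dots>
             = T 0 (Suc n) + (\<Sum>k\<le>n. of_nat (Suc n choose Suc k) * T (Suc k) (n - k))"
      by (simp add: algebra_simps flip: sum.distrib)
    also have "\<dots> = (\<Sum>k\<le>Suc n. of_nat (Suc n choose k) * T k (Suc n - k))"
      by (subst sum.atMost_Suc_shift) simp
    finally show ?case
      by (simp add: T_def)
  qed simp
  have psum: "(pderiv ^^ n) (\<Sum>k\<in>A. f k) = (\<Sum>k\<in>A. (pderiv ^^ n) (f k))"
    for A :: "'a set" and f :: "'a \<Rightarrow> complex poly"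
    by (rule higher_pderiv_sum)
  have "((mp_deriv ^^ n) (P ** Q)) $ i $ j =
     (\<Sum>k\<le>n. mat (of_nat (n choose k)) ** ((mp_deriv ^^ k) P ** (mp_deriv ^^ (n - k)) Q)) $ i $ j"
    for i j
  proof -
    have "((mp_deriv ^^ n) (P ** Q)) $ i $ j
        = (\<Sum>l\<in>UNIV. \<Sum>k\<le>n. of_nat (n choose k)
             * ((pderiv ^^ k) (P $ i $ l) * (pderiv ^^ (n - k)) (Q $ l $ j)))"
      by (simp add: higher matrix_matrix_mult_def psum poly)
    also have "\<dots> = (\<Sum>k\<le>n. of_nat (n choose k)
             * (\<Sum>l\<in>UNIV. (pderiv ^^ k) (P $ i $ l) * (pderiv ^^ (n - k)) (Q $ l $ j)))"
      by (subst sum.swap) (simp add: sum_distrib_left)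
    also have "\<dots> = (\<Sum>k\<le>n. (mat (of_nat (n choose k)) **
        ((mp_deriv ^^ k) P ** (mp_deriv ^^ (n - k)) Q)) $ i $ j)"
      unfolding mat_mult_entry by (simp add: matrix_matrix_mult_def higher)
    finally show ?thesis
      by simp
  qed
  then show ?thesis
    by (simp add: vec_eq_iff)
qed

lemma diffop_act_bound:
  assumes "degree D \<le> N"
  shows "diffop_act P D = (\<Sum>i\<le>N. (mp_deriv ^^ i) P ** coeff D i)"
  unfolding diffop_act_def
  by (rule sum.mono_neutral_left) (use assms in \<open>auto simp: coeff_eq_0 matrix_mult_0_right not_le\<close>)

lemma diffop_act_add: "diffop_act P (D + E) = diffop_act P D + diffop_act P E"
proof -
  let ?N = "max (degree D) (degree E)"
  have "degree (D + E) \<le> ?N"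
    by (rule degree_add_le) auto
  then show ?thesis
    by (simp add: diffop_act_bound[of _ ?N] matrix_add_ldistrib sum.distrib)
qed

lemma diffop_act_0 [simp]: "diffop_act P 0 = 0"
  by (simp add: diffop_act_def matrix_mult_0_right)

lemma diffop_act_sum: "diffop_act P (\<Sum>i\<in>A. D i) = (\<Sum>i\<in>A. diffop_act P (D i))"
  by (induction A rule: infinite_finite_induct) (simp_all add: diffop_act_add)

lemma diffop_act_monom: "diffop_act P (monom F n) = (mp_deriv ^^ n) P ** F"
proof -
  have "diffop_act P (monom F n) = (\<Sum>i\<le>n. if i = n then (mp_deriv ^^ i) P ** F else 0)"
    unfolding diffop_act_bound[OF degree_monom_le]
    by (rule sum.cong) (auto simp: matrix_mult_0_right)
  then show ?thesis
    by simp
qed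

lemma diffop_act_mult: "diffop_act P (diffop_mult D E) = diffop_act (diffop_act P D) E"
proof -
  have pow: "(mp_deriv ^^ (i + k)) P = (mp_deriv ^^ k) ((mp_deriv ^^ i) P)" for i k
    by (simp add: add.commute[of i k] funpow_add)
  have "diffop_act (diffop_act P D) E
      = (\<Sum>j\<le>degree E. \<Sum>i\<le>degree D. (mp_deriv ^^ j) ((mp_deriv ^^ i) P ** coeff D i) ** coeff E j)"
    by (simp add: diffop_act_def mp_deriv_pow_sum matrix_mult_sum_left)
  also have "\<dots> = (\<Sum>i\<le>degree D. \<Sum>j\<le>degree E.
      (mp_deriv ^^ j) ((mp_deriv ^^ i) P ** coeff D i) ** coeff E j)"
    by (rule sum.swap)
  also have "\<dots> = diffop_act P (diffop_mult D E)"
    unfolding diffop_mult_def diffop_act_sum diffop_act_monom mp_leibniz matrix_mult_sum_left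
    by (intro sum.cong refl)
      (simp add: mat_scalar_commute matrix_mul_assoc[symmetric] pow)
  finally show ?thesis ..
qed

text \<open>The subalgebra over the complex numbers generated by a set of operators.\<close>

inductive_set diffop_alg :: "'n::finite diffop set \<Rightarrow> 'n diffop set" for G where
  base: "D \<in> G \<Longrightarrow> D \<in> diffop_alg G"
| zero: "0 \<in> diffop_alg G"
| add: "D \<in> diffop_alg G \<Longrightarrow> E \<in> diffop_alg G \<Longrightarrow> D + E \<in> diffop_alg G"
| scale: "D \<in> diffop_alg G \<Longrightarrow> diffop_scale c D \<in> diffop_alg G"
| mult: "D \<in> diffop_alg G \<Longrightarrow> E \<in> diffop_alg G \<Longrightarrow> diffop_mult D E \<in> diffop_alg G"

definition diffop_algebra_of ::
  "real set \<Rightarrow> (real \<Rightarrow> complex ^ 'n ^ 'n) \<Rightarrow> 'n::finite diffop set"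
where
  "diffop_algebra_of S W =
     {D. \<forall>n. \<exists>L. diffop_act (monic_ortho S W n) D = mp_const L ** monic_ortho S W n}"

subsection \<open>The example\<close>

definition mat2 :: "'a \<Rightarrow> 'a \<Rightarrow> 'a \<Rightarrow> 'a \<Rightarrow> 'a::zero ^ 2 ^ 2" where
  "mat2 p q r s = vector [vector [p, q], vector [r, s]]"

definition W_ex :: "real \<Rightarrow> real \<Rightarrow> complex ^ 2 ^ 2" where
  "W_ex a x = exp (- x\<^sup>2) *\<^sub>R
     mat2 (of_real (1 + a\<^sup>2 * x\<^sup>2)) (of_real (a * x))
          (of_real (a * x))          1"

definition D1_ex :: "real \<Rightarrow> 2 diffop" where
  "D1_ex a = (let a = complex_of_real a in
     [: mat2 0             [:2 + 4 / a\<^sup>2:]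
             [:4 / a\<^sup>2:]    0,
        mat2 [:- 2 * a:]   [:0, 2 * a\<^sup>2 + 4:]
             0             0,
        mat2 [:0, - a:]    [:- 1, 0, a\<^sup>2:]
             (- 1)         [:0, a:] :])"

definition D5_ex :: "real \<Rightarrow> 2 diffop" where
  "D5_ex a = (let a = complex_of_real a in
     [: mat2 [:- 2 - 4 / a\<^sup>2:]  0
             0                  [:- 4 / a\<^sup>2:],
        mat2 [:0, - 2:]         [:2 * a:]
             0                  [:0, - 2:],
        mat 1 :])"

end

theory Submission
  imports Defs "HOL-Probability.Distributions"
begin

text \<open>
  Write \<open>\<nu> = n + 2/a\<^sup>2\<close>. The orthogonal polynomials \<open>P\<^sub>n\<close> are explicit in terms of Hermite polynomials,
  and \<open>D \<mapsto> (\<Lambda>\<^sub>n(D))\<^sub>n\<close> is an injective algebra homomorphism. Comparing leading coefficients in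
  \<open>P\<^sub>n \<cdot> D = \<Lambda>\<^sub>n P\<^sub>n\<close> shows that the entries of \<open>\<Lambda>\<^sub>n\<close> are polynomials \<open>f\<^sub>i\<^sub>j(\<nu>)\<close>; comparing subleading
  ones, whose rational dependence on \<open>\<nu>\<close> has a pole at \<open>0\<close>, gives
  \<open>f\<^sub>1\<^sub>2(0) = f\<^sub>1\<^sub>2(-1) = 0\<close> and \<open>f\<^sub>2\<^sub>2(0) = f\<^sub>1\<^sub>1(-1)\<close>. On the other hand \<open>D\<^sub>5\<close> has eigenvalue
  \<open>-2 diag(\<nu> + 1, \<nu>)\<close> and \<open>D\<^sub>1\<close> has the off-diagonal entries \<open>a\<^sup>2 \<nu> (\<nu> + 1)\<close> and \<open>4/a\<^sup>2\<close>, and these two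
  matrices generate all polynomial matrices subject to these three conditions.
\<close>

subsection \<open>Linearity of the action\<close>

lemma mp_eq_iff: "P = Q \<longleftrightarrow> (\<forall>k. mp_coeff P k = mp_coeff Q k)"
  by (auto simp: mp_coeff_def vec_eq_iff poly_eq_iff)

lemma mp_coeff_0 [simp]: "mp_coeff 0 k = 0"
  by (simp add: mp_coeff_def vec_eq_iff)

lemma mp_coeff_add: "mp_coeff (P + Q) k = mp_coeff P k + mp_coeff Q k"
  by (simp add: mp_coeff_def vec_eq_iff)

lemma mp_coeff_diff: "mp_coeff (P - Q) k = mp_coeff P k - mp_coeff Q k"
  by (simp add: mp_coeff_def vec_eq_iff)

lemma mp_coeff_const_mult: "mp_coeff (mp_const C ** P) k = C ** mp_coeff P k"
  by (simp add: mp_coeff_def mp_const_def matrix_matrix_mult_def vec_eq_iff coeff_sum)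

lemma mp_const_mult: "mp_const (A ** B) = mp_const A ** mp_const B"
  by (simp add: mp_const_def matrix_matrix_mult_def vec_eq_iff poly_eq_iff coeff_sum
      coeff_pCons mult.commute split: nat.split)

lemma mp_const_add: "mp_const (A + B) = mp_const A + mp_const B"
  by (simp add: mp_const_def vec_eq_iff)

lemma mp_const_0 [simp]: "mp_const 0 = 0"
  by (simp add: mp_const_def vec_eq_iff)

lemma mp_const_mat: "mp_const (mat c) = mat [:c:]"
  by (simp add: mp_const_def mat_def vec_eq_iff)

lemma matrix_mult_0_left [simp]: "(0 :: 'a::comm_ring_1 ^ 'n ^ 'n) ** A = 0"
  by (simp add: matrix_matrix_mult_def vec_eq_iff)

lemma mp_deriv_const_mult: "mp_deriv (mp_const C ** P) = mp_const C ** mp_deriv P"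
  by (simp add: mp_deriv_def mp_const_def matrix_matrix_mult_def vec_eq_iff
      higher_pderiv_sum[of 1, simplified] pderiv_smult)

lemma mp_deriv_pow_const_mult:
  "(mp_deriv ^^ i) (mp_const C ** P) = mp_const C ** (mp_deriv ^^ i) P"
  by (induction i) (simp_all add: mp_deriv_const_mult)

lemma mp_deriv_pow_entry: "(mp_deriv ^^ i) P $ r $ s = (pderiv ^^ i) (P $ r $ s)"
  by (induction i) (simp_all add: mp_deriv_def)

lemma matrix_mult_sum_right: "A ** (\<Sum>i\<in>I. f i) = (\<Sum>i\<in>I. (A :: 'a::comm_ring_1 ^ 'n ^ 'n) ** f i)"
  by (induction I rule: infinite_finite_induct) (simp_all add: matrix_mult_0_right matrix_add_ldistrib)

lemma matrix_mult_add_left: "(A + B) ** C = A ** C + B ** (C :: 'a::comm_ring_1 ^ 'n ^ 'n)"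
  by (simp add: matrix_matrix_mult_def vec_eq_iff distrib_right sum.distrib)

lemma diffop_act_add_left: "diffop_act (P + Q) D = diffop_act P D + diffop_act Q D"
  by (simp add: diffop_act_def mp_deriv_pow_add matrix_mult_add_left sum.distrib)

lemma diffop_act_zero_left [simp]: "diffop_act 0 D = 0"
  by (simp add: diffop_act_def)

lemma diffop_act_const_left: "diffop_act (mp_const C ** P) D = mp_const C ** diffop_act P D"
  by (simp add: diffop_act_def mp_deriv_pow_const_mult matrix_mult_sum_right matrix_mul_assoc)

lemma diffop_act_one: "diffop_act P diffop_one = P"
  by (simp add: diffop_act_def diffop_one_def)

lemma diffop_act_scale: "diffop_act P (diffop_scale c D) = mp_const (mat c) ** diffop_act P D"
proof -
  have "degree (diffop_scale c D) \<le> degree D"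
    unfolding diffop_scale_def by (rule map_poly_degree_leq)
  then show ?thesis
    by (simp add: diffop_act_bound[of _ "degree D"] diffop_scale_def coeff_map_poly
        matrix_mult_0_right mp_const_mat mat_scalar_commute matrix_mult_sum_right)
qed

subsection \<open>Monic sequences of matrix polynomials\<close>

text \<open>Subtracting \<open>mp_const C ** P m\<close>, with \<open>C\<close> the top coefficient,
  lowers the degree, so a monic sequence is a basis over the constant matrices acting from the
  left.\<close>

lemma mp_monic_induct [consumes 2, case_names zero step]:
  assumes monic: "\<And>n. mp_monic n (P n)" and "\<forall>k\<ge>n. mp_coeff Q k = 0"
    and zero: "Pr 0"
    and step: "\<And>m C Q. m < n \<Longrightarrow> \<forall>k\<ge>m. mp_coeff Q k = 0 \<Longrightarrow> Pr Q \<Longrightarrow> Pr (mp_const C ** P m + Q)"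
  shows "Pr Q"
  using assms(2) step
proof (induction n arbitrary: Q)
  case 0
  then have "Q = 0" by (simp add: mp_eq_iff)
  then show ?case using zero by simp
next
  case (Suc n)
  define C where "C = mp_coeff Q n"
  define Q' where "Q' = Q - mp_const C ** P n"
  have lower: "\<forall>k\<ge>n. mp_coeff Q' k = 0"
  proof (intro allI impI)
    fix k assume "k \<ge> n"
    then consider "k = n" | "k > n" by linarith
    then show "mp_coeff Q' k = 0"
      using monic[of n] Suc.prems(1)
      by cases (simp_all add: Q'_def mp_coeff_diff mp_coeff_const_mult mp_monic_def C_def
          matrix_mult_0_right)
  qed
  then have "Pr Q'"
    using Suc.IH Suc.prems(2) less_SucI by blast
  then have "Pr (mp_const C ** P n + Q')"
    using Suc.prems(2) lower by blast
  then show ?case by (simp add: Q'_def)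
qed

text \<open>Each \<open>P m\<close> goes to a left multiple of itself, and the \<open>P m\<close>
  with \<open>m < n\<close> span everything of degree below \<open>n\<close>.\<close>

lemma diffop_act_degree_le:
  assumes "\<And>n. mp_monic n (P n)" and "\<forall>k\<ge>n. mp_coeff Q k = 0"
    and eig: "\<And>n. diffop_act (P n) D = mp_const (L n) ** P n"
  shows "\<forall>k\<ge>n. mp_coeff (diffop_act Q D) k = 0"
  using assms(1,2)
proof (induction rule: mp_monic_induct)
  case (step m C Q)
  have "mp_coeff (P m) k = 0" if "k \<ge> n" for k
    using assms(1)[of m] step that by (simp add: mp_monic_def)
  with step show ?case
    by (simp add: diffop_act_add_left diffop_act_const_left eig mp_coeff_add mp_coeff_const_mult
        matrix_mult_0_right)
qed simp

lemma mp_monic_diff_monom: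
  assumes "mp_monic n P"
  shows "\<forall>k\<ge>n. mp_coeff (P - mat (monom 1 n)) k = 0"
proof (intro allI impI)
  fix k assume "k \<ge> n"
  then have "mp_coeff P k = (if k = n then mat 1 else 0)"
    using assms by (auto simp: mp_monic_def)
  moreover have "mp_coeff (mat (monom 1 n) :: 'a matpoly) k = (if k = n then mat 1 else 0)"
    by (auto simp: mp_coeff_def mat_def vec_eq_iff)
  ultimately show "mp_coeff (P - mat (monom 1 n)) k = 0"
    by (simp add: mp_coeff_diff)
qed

text \<open>\<open>P n\<close> and x^n I differ by a polynomial of degree below \<open>n\<close>,
  and \<open>D\<close> keeps its degree below \<open>n\<close>. So the eigenvalue can be read off
  from the coefficients of \<open>D\<close> alone.\<close>

lemma eigenvalue_eq_coeff:
  assumes "\<And>n. mp_monic n (P n)"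
    and eig: "\<And>n. diffop_act (P n) D = mp_const (L n) ** P n"
  shows "L n = mp_coeff (diffop_act (mat (monom 1 n)) D) n"
proof -
  define Q where "Q = P n - mat (monom 1 n)"
  have "mp_coeff (diffop_act Q D) n = 0"
    using diffop_act_degree_le[OF assms(1) _ eig, of n Q] mp_monic_diff_monom[OF assms(1)]
    by (simp add: Q_def)
  moreover have "diffop_act (P n) D = diffop_act (mat (monom 1 n)) D + diffop_act Q D"
    by (simp add: Q_def flip: diffop_act_add_left)
  moreover have "mp_coeff (P n) n = mat 1"
    using assms(1) by (simp add: mp_monic_def)
  ultimately show ?thesis
    using eig[of n] by (metis add.right_neutral matrix_mul_rid mp_coeff_add mp_coeff_const_mult)
qed

text \<open>Expand \<open>P (Suc n)\<close> as x^(n+1) I plus \<open>B\<close> times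
  \<open>P n\<close> plus terms of degree below \<open>n\<close>, with \<open>B\<close> its
  subleading coefficient, and compare coefficients of x^n.\<close>

lemma eigenvalue_subleading:
  assumes monic: "\<And>n. mp_monic n (P n)"
    and eig: "\<And>n. diffop_act (P n) D = mp_const (L n) ** P n"
  shows "L (Suc n) ** mp_coeff (P (Suc n)) n =
           mp_coeff (diffop_act (mat (monom 1 (Suc n))) D) n + mp_coeff (P (Suc n)) n ** L n"
proof -
  define B where "B = mp_coeff (P (Suc n)) n"
  define Q where "Q = P (Suc n) - mat (monom 1 (Suc n)) - mp_const B ** P n"
  have lead: "mp_coeff (P n) n = mat 1"
    using monic by (simp add: mp_monic_def)
  have "\<forall>k\<ge>n. mp_coeff Q k = 0"
  proof (intro allI impI)
    fix k assume "k \<ge> n"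
    then consider "k = n" | "k \<ge> Suc n" by linarith
    then show "mp_coeff Q k = 0"
    proof cases
      case 1
      have "mp_coeff (mat (monom 1 (Suc n)) :: 'a matpoly) n = 0"
        by (simp add: mp_coeff_def mat_def vec_eq_iff)
      then show ?thesis
        using 1 lead by (simp add: Q_def B_def mp_coeff_diff mp_coeff_const_mult)
    next
      case 2
      then show ?thesis
        using mp_monic_diff_monom[OF monic[of "Suc n"]] monic[of n]
        by (simp add: Q_def mp_coeff_diff mp_coeff_const_mult mp_monic_def matrix_mult_0_right)
    qed
  qed
  then have Q: "mp_coeff (diffop_act Q D) n = 0"
    using diffop_act_degree_le[OF monic _ eig] by blast
  have "P (Suc n) = mat (monom 1 (Suc n)) + (mp_const B ** P n + Q)"
    by (simp add: Q_def)
  then have "diffop_act (P (Suc n)) D =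
      diffop_act (mat (monom 1 (Suc n))) D + (mp_const B ** (mp_const (L n) ** P n) + diffop_act Q D)"
    by (metis diffop_act_add_left diffop_act_const_left eig)
  then have "mp_coeff (mp_const (L (Suc n)) ** P (Suc n)) n =
      mp_coeff (diffop_act (mat (monom 1 (Suc n))) D) n + B ** L n"
    by (simp add: eig mp_coeff_add mp_coeff_const_mult Q lead)
  then show ?thesis
    by (simp add: mp_coeff_const_mult B_def)
qed

section \<open>Faithfulness of the action on a monic sequence\<close>

lemma mp_deriv_pow_monic:
  assumes "mp_monic n P"
  shows "(mp_deriv ^^ n) P = mat (of_nat (fact n))" and "k > n \<Longrightarrow> (mp_deriv ^^ k) P = 0"
proof -
  have coeff: "coeff (P $ r $ s) j = (if j = n then mat 1 $ r $ s else 0)" if "j \<ge> n" for j r s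
    using assms that unfolding mp_monic_def mp_coeff_def
    by (metis (no_types, lifting) order_le_neq_trans vec_lambda_beta zero_index)
  have 1: "(pderiv ^^ n) (P $ r $ s) = (mat (of_nat (fact n)) :: 'a matpoly) $ r $ s" for r s
  proof (rule poly_eqI)
    fix j
    show "coeff ((pderiv ^^ n) (P $ r $ s)) j = coeff ((mat (of_nat (fact n)) :: 'a matpoly) $ r $ s) j"
      by (cases "j = 0") (auto simp: coeff_higher_pderiv coeff mat_def pochhammer_fact
          of_nat_poly coeff_pCons split: nat.splits simp flip: pochhammer_of_nat)
  qed
  show "(mp_deriv ^^ n) P = mat (of_nat (fact n))"
    by (simp add: vec_eq_iff mp_deriv_pow_entry 1)
  assume "k > n"
  then have "(pderiv ^^ k) (P $ r $ s) = 0" for r s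
    by (intro poly_eqI) (simp add: coeff_higher_pderiv coeff)
  then show "(mp_deriv ^^ k) P = 0"
    by (simp add: vec_eq_iff mp_deriv_pow_entry)
qed

text \<open>If \<open>F\<^sub>0, \<dots>, F\<^bsub>i-1\<^esub>\<close> vanish, then \<open>P\<^sub>i \<cdot> D = i! F\<^sub>i\<close>.\<close>

lemma diffop_eq_0:
  assumes monic: "\<And>n. mp_monic n (P n)" and zero: "\<And>n. diffop_act (P n) D = 0"
  shows "D = 0"
proof (rule poly_eqI)
  fix i
  show "coeff D i = coeff 0 i"
  proof (induction i rule: less_induct)
    case (less i)
    have "0 = diffop_act (P i) D" by (simp add: zero)
    also have "\<dots> = (\<Sum>j\<le>max i (degree D). (mp_deriv ^^ j) (P i) ** coeff D j)"
      by (rule diffop_act_bound) simp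
    also have "\<dots> = (\<Sum>j\<in>{i}. (mp_deriv ^^ j) (P i) ** coeff D j)"
    proof (rule sum.mono_neutral_right)
      have "(mp_deriv ^^ j) (P i) ** coeff D j = 0" if "j \<noteq> i" for j
        using that less[of j] mp_deriv_pow_monic(2)[OF monic[of i], of j]
        by (cases "j < i") (auto simp: matrix_mult_0_right)
      then show "\<forall>j\<in>{..max i (degree D)} - {i}. (mp_deriv ^^ j) (P i) ** coeff D j = 0"
        by blast
    qed auto
    also have "\<dots> = mat (of_nat (fact i)) ** coeff D i"
      by (simp add: mp_deriv_pow_monic(1)[OF monic])
    finally have "(mat (of_nat (fact i)) ** coeff D i) $ r $ s = 0" for r s
      by (metis zero_index)
    then have "coeff D i $ r $ s = 0" for r s
      by (simp add: mat_mult_entry)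
    then show ?case by (simp add: vec_eq_iff)
  qed
qed

text \<open>The difference of the operators kills every \<open>P n\<close>. An operator is therefore
  determined by its eigenvalue sequence.\<close>

lemma diffop_eqI:
  assumes "\<And>n. mp_monic n (P n)" and "\<And>n. diffop_act (P n) D = diffop_act (P n) E"
  shows "D = E"
proof -
  have "diffop_act (P n) (D - E) = 0" for n
    using diffop_act_add[of "P n" "D - E" E] assms(2) by simp
  then have "D - E = 0" by (rule diffop_eq_0[OF assms(1)])
  then show ?thesis by simp
qed

section \<open>Polynomial dependence on n of the coefficients of x^n I acted on by D\<close>

lemma higher_pderiv_monom_ffact:
  "(pderiv ^^ i) (monom (1 :: complex) n) = monom (\<Prod>l<i. of_nat n - of_nat l) (n - i)"
proof (induction i)
  case (Suc i)
  \<comment> \<open>For \<open>i > n\<close> both sides vanish, since the falling factorial contains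
    the factor with \<open>l = n\<close>; so the formula stays polynomial in \<open>n\<close>
    despite truncated subtraction.\<close>
  have "of_nat (n - i) * (\<Prod>l<i. of_nat n - of_nat l :: complex) = (\<Prod>l<Suc i. of_nat n - of_nat l)"
  proof (cases "i \<le> n")
    case True
    then show ?thesis by (simp add: of_nat_diff)
  next
    case False
    then have "(\<Prod>l<i. of_nat n - of_nat l :: complex) = 0" by auto
    then show ?thesis by simp
  qed
  then show ?case by (simp add: Suc pderiv_monom)
qed simp

text \<open>The i-th term of \<open>D\<close> contributes a falling factorial of \<open>n\<close>
  times one fixed coefficient of F_i, so one polynomial serves all \<open>n\<close>. The shift
  \<open>c\<close> turns it into a polynomial in \<nu>; \<open>j = 0\<close> serves the eigenvalues,
  \<open>j = 1\<close> the subleading coefficients.\<close>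

lemma coeff_diffop_act_monom_poly:
  fixes D :: "'n::finite diffop" and c :: complex
  shows "\<exists>p. \<forall>n\<ge>j. mp_coeff (diffop_act (mat (monom 1 n)) D) (n - j) $ r $ s = poly p (of_nat n + c)"
proof -
  \<comment> \<open>x^(n-i) reaches x^(n-j) only through the coefficient of x^(i-j) in F_i, which
    requires i \<ge> j. At n + c the product is the falling factorial of n.\<close>
  define q where "q i = (if i < j then 0
      else smult (coeff (coeff D i $ r $ s) (i - j)) (\<Prod>l<i. [:- c - of_nat l, 1:]))" for i
  have deriv_mat: "(mp_deriv ^^ i) (mat p :: 'n matpoly) = mat ((pderiv ^^ i) p)" for i p
    by (simp add: vec_eq_iff mp_deriv_pow_entry mat_def)
  have q: "coeff ((pderiv ^^ i) (monom 1 n) * (coeff D i $ r $ s)) (n - j) = poly (q i) (of_nat n + c)"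
    if "n \<ge> j" for i n
  proof (cases "i \<le> n")
    case True
    then show ?thesis
      using that by (auto simp: higher_pderiv_monom_ffact coeff_monom_mult q_def poly_prod)
  next
    case False
    then have 0: "(\<Prod>l<i. of_nat n - of_nat l :: complex) = 0" by auto
    show ?thesis by (simp add: higher_pderiv_monom_ffact q_def poly_prod 0)
  qed
  show ?thesis
  proof (intro exI allI impI)
    fix n assume "n \<ge> j"
    then show "mp_coeff (diffop_act (mat (monom 1 n)) D) (n - j) $ r $ s
        = poly (\<Sum>i\<le>degree D. q i) (of_nat n + c)"
      by (simp add: mp_coeff_def diffop_act_def deriv_mat mat_mult_entry coeff_sum poly_sum q)
  qed
qed

text \<open>A nonzero polynomial has only finitely many roots. Identities known at the values of
  \<open>nu\<close> thus extend to 0, which is not such a value.\<close>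

lemma poly_eq_of_nat_shift:
  fixes p q :: "complex poly"
  assumes "\<And>n. poly p (of_nat (Suc n) + c) = poly q (of_nat (Suc n) + c)"
  shows "p = q"
proof (rule ccontr)
  assume "p \<noteq> q"
  then have "finite {x. poly (p - q) x = 0}"
    by (intro poly_roots_finite) simp
  moreover have "range (\<lambda>n. of_nat (Suc n) + c) \<subseteq> {x. poly (p - q) x = 0}"
    using assms by auto
  moreover have "infinite (range (\<lambda>n. of_nat (Suc n) + c :: complex))"
    by (rule range_inj_infinite) (auto intro!: injI simp del: of_nat_Suc)
  ultimately show False
    using finite_subset by blast
qed

subsection \<open>Monic Hermite polynomials\<close>

text \<open>These are the physicists' Hermite polynomials divided by 2^n, built with the raising
  operator x - (1/2) d/dx.\<close>

fun hermite :: "nat \<Rightarrow> complex poly" where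
  "hermite 0 = 1"
| "hermite (Suc n) = [:0, 1:] * hermite n - smult (1/2) (pderiv (hermite n))"

lemma pderiv_hermite_Suc: "pderiv (hermite (Suc n)) = smult (of_nat (Suc n)) (hermite n)"
proof (induction n)
  case 0
  show ?case by (simp add: pderiv_pCons one_pCons)
next
  case (Suc n)
  have "pderiv (hermite (Suc (Suc n))) =
      hermite (Suc n) + [:0, 1:] * pderiv (hermite (Suc n)) - smult (1/2) (pderiv (pderiv (hermite (Suc n))))"
    by (subst hermite.simps(2))
      (simp add: pderiv_diff pderiv_mult pderiv_smult pderiv_pCons del: hermite.simps)
  also have "\<dots> = hermite (Suc n) +
      smult (of_nat (Suc n)) ([:0, 1:] * hermite n - smult (1/2) (pderiv (hermite n)))"
    unfolding Suc by (simp add: pderiv_smult smult_diff_right del: hermite.simps)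
  also have "\<dots> = smult (of_nat (Suc (Suc n))) (hermite (Suc n))"
    unfolding hermite.simps(2)[symmetric]
    by (simp only: of_nat_Suc[of "Suc n"] smult_add_left smult_1_left)
  finally show ?case .
qed

text \<open>Hermite's equation: differentiate the recursion for \<open>hermite (Suc n)\<close> and
  rewrite the left side by the lowering rule.\<close>

lemma pderiv_pderiv_hermite:
  "pderiv (pderiv (hermite n)) = [:0, 2:] * pderiv (hermite n) - smult (2 * of_nat n) (hermite n)"
proof -
  have "smult (of_nat (Suc n)) (hermite n) = pderiv (hermite (Suc n))"
    by (rule pderiv_hermite_Suc[symmetric])
  also have "\<dots> = hermite n + [:0, 1:] * pderiv (hermite n) - smult (1/2) (pderiv (pderiv (hermite n)))"
    by (simp add: pderiv_diff pderiv_mult pderiv_smult pderiv_pCons)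
  finally have "smult 2 (smult (of_nat (Suc n)) (hermite n)) = smult 2 (hermite n
      + [:0, 1:] * pderiv (hermite n) - smult (1/2) (pderiv (pderiv (hermite n))))"
    by (rule arg_cong)
  then show ?thesis
    by (simp add: poly_eq_poly_eq_iff[symmetric] fun_eq_iff algebra_simps)
qed

text \<open>The recursion combines a shift up by one degree with a shift down by one, so no
  subleading term ever appears.\<close>

lemma coeff_hermite:
  "coeff (hermite n) n = 1" "k > n \<Longrightarrow> coeff (hermite n) k = 0" "coeff (hermite (Suc n)) n = 0"
proof -
  have *: "coeff (hermite n) n = 1 \<and> (\<forall>k>n. coeff (hermite n) k = 0) \<and> coeff (hermite (Suc n)) n = 0" for n
  proof (induction n)
    case 0
    show ?case by (auto simp: pderiv_pCons one_pCons coeff_pCons split: nat.splits)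
  next
    case (Suc n)
    have "coeff (hermite (Suc n)) (Suc n) = 1"
      using Suc by (simp add: coeff_pderiv)
    moreover have "coeff (hermite (Suc n)) k = 0" if "k > Suc n" for k
      using Suc that by (cases k) (auto simp: coeff_pderiv)
    moreover from this have "coeff (hermite (Suc (Suc n))) (Suc n) = 0"
      using Suc by (subst hermite.simps(2)) (simp add: coeff_pderiv del: hermite.simps)
    ultimately show ?case by blast
  qed
  show "coeff (hermite n) n = 1" "k > n \<Longrightarrow> coeff (hermite n) k = 0" "coeff (hermite (Suc n)) n = 0"
    using * by blast+
qed

text \<open>Real values allow dropping the conjugation in the inner product. The derivative joins
  the induction because the recursion involves it.\<close>

lemma poly_hermite_real: "poly (hermite n) (of_real x) \<in> \<real>"
proof -
  have "poly (hermite n) (of_real x) \<in> \<real> \<and> poly (pderiv (hermite n)) (of_real x) \<in> \<real>"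
    by (induction n) (auto simp: pderiv_hermite_Suc simp del: hermite.simps(2), simp_all)
  then show ?thesis ..
qed

lemma poly_pderiv_hermite_real: "poly (pderiv (hermite n)) (of_real x) \<in> \<real>"
  by (cases n) (simp_all add: pderiv_hermite_Suc poly_hermite_real del: hermite.simps(2))

subsection \<open>The Gaussian functional\<close>

definition gauss_int :: "complex poly \<Rightarrow> complex" where
  "gauss_int p = (LINT x|lborel. exp (- x\<^sup>2) *\<^sub>R poly p (of_real x))"

lemma gauss_moment:
  "has_bochner_integral lborel (\<lambda>x. exp (- x\<^sup>2) *\<^sub>R (complex_of_real x ^ n))
     (if even n then of_real (sqrt pi * fact n / (2 ^ n * fact (n div 2))) else 0)"
proof (cases "even n")
  case True
  then obtain k where n: "n = 2 * k" by (elim evenE)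
  have "has_bochner_integral lborel (\<lambda>x::real. exp (-x\<^sup>2) * x ^ n) (sqrt pi * fact n / (2 ^ n * fact k))"
    using has_bochner_integral_even_function[OF gaussian_moment_even_pos[of k]] by (simp add: n)
  then have "has_bochner_integral lborel (\<lambda>x::real. of_real (exp (-x\<^sup>2) * x ^ n))
      (complex_of_real (sqrt pi * fact n / (2 ^ n * fact k)))"
    by (rule has_bochner_integral_of_real)
  then show ?thesis
    using True by (simp add: n scaleR_conv_of_real)
next
  case False
  then obtain k where n: "n = 2 * k + 1" by (elim oddE)
  have "has_bochner_integral lborel (\<lambda>x::real. exp (-x\<^sup>2) * x ^ n) 0"
    using has_bochner_integral_odd_function[OF gaussian_moment_odd_pos[of k]] by (simp add: n)
  then have "has_bochner_integral lborel (\<lambda>x::real. of_real (exp (-x\<^sup>2) * x ^ n)) (complex_of_real 0)"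
    by (rule has_bochner_integral_of_real)
  then show ?thesis
    using False by (simp add: scaleR_conv_of_real)
qed

lemma gauss_integrable: "integrable lborel (\<lambda>x. exp (- x\<^sup>2) *\<^sub>R poly p (complex_of_real x))"
proof -
  have eq: "(\<lambda>x. exp (- x\<^sup>2) *\<^sub>R poly p (complex_of_real x)) =
      (\<lambda>x. \<Sum>i\<le>degree p. coeff p i * (exp (- x\<^sup>2) *\<^sub>R (complex_of_real x ^ i)))"
    by (simp add: poly_altdef scaleR_sum_right)
  show ?thesis
    unfolding eq
    by (intro Bochner_Integration.integrable_sum Bochner_Integration.integrable_mult_right)
      (rule gauss_moment[unfolded has_bochner_integral_iff, THEN conjunct1])
qed

lemma gauss_int_add: "gauss_int (p + q) = gauss_int p + gauss_int q"
  by (simp add: gauss_int_def scaleR_add_right gauss_integrable Bochner_Integration.integral_add)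

lemma gauss_int_smult: "gauss_int (smult c p) = c * gauss_int p"
  by (simp add: gauss_int_def mult_scaleR_right[symmetric] del: mult_scaleR_right)

lemma gauss_int_0 [simp]: "gauss_int 0 = 0"
  by (simp add: gauss_int_def)

lemma gauss_int_diff: "gauss_int (p - q) = gauss_int p - gauss_int q"
  using gauss_int_add[of "p - q" q] by simp

lemma gauss_int_minus: "gauss_int (- p) = - gauss_int p"
  using gauss_int_diff[of 0 p] by simp

lemma gauss_int_monom:
  "gauss_int (monom 1 n) = (if even n then of_real (sqrt pi * fact n / (2 ^ n * fact (n div 2))) else 0)"
  using gauss_moment[of n] unfolding gauss_int_def has_bochner_integral_iff by (simp add: poly_monom)

text \<open>This is integration by parts against exp(-x^2). It is derived from the moments by
  linearity, so no boundary terms arise.\<close>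

lemma gauss_int_pderiv: "gauss_int (pderiv p) = 2 * gauss_int ([:0, 1:] * p)"
proof -
  have monom: "gauss_int (pderiv (monom 1 n)) = 2 * gauss_int ([:0, 1:] * monom 1 n)" for n
  proof (cases n)
    case 0
    have "gauss_int (monom 1 1) = 0"
      by (subst gauss_int_monom) simp
    then show ?thesis
      using 0 by (simp add: monom_altdef one_pCons)
  next
    case (Suc m)
    have 1: "gauss_int (pderiv (monom 1 n)) = of_nat (Suc m) * gauss_int (monom 1 m)"
      by (simp add: Suc pderiv_monom smult_monom flip: gauss_int_smult)
    have 2: "[:0, 1:] * monom 1 n = monom (1::complex) (Suc (Suc m))"
      by (simp add: Suc monom_Suc)
    \<comment> \<open>Moment recursion: the moment of order m + 2 is (m + 1)/2 times that of order
      m.\<close>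
    have "of_nat (Suc m) * gauss_int (monom 1 m) = 2 * gauss_int (monom 1 (Suc (Suc m)))"
    proof (cases "even m")
      case True
      then obtain k where k: "m = 2 * k" by (elim evenE)
      have "real (Suc m) * (sqrt pi * fact m / (2 ^ m * fact k)) =
          2 * (sqrt pi * fact (Suc (Suc m)) / (2 ^ Suc (Suc m) * fact (Suc k)))"
        by (simp add: k divide_simps)
      from arg_cong[OF this, of complex_of_real] show ?thesis
        using k by (simp add: gauss_int_monom del: fact_Suc power_Suc of_nat_Suc)
    next
      case False
      then show ?thesis by (simp add: gauss_int_monom)
    qed
    then show ?thesis unfolding 1 2 .
  qed
  have sum: "gauss_int (\<Sum>i\<in>A. f i) = (\<Sum>i\<in>A. gauss_int (f i))" for A :: "nat set" and f
    by (induction A rule: infinite_finite_induct) (simp_all add: gauss_int_add)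
  have p: "p = (\<Sum>i\<le>degree p. smult (coeff p i) (monom 1 i))"
    by (simp add: smult_monom poly_as_sum_of_monoms)
  have "pderiv p = (\<Sum>i\<le>degree p. smult (coeff p i) (pderiv (monom 1 i)))"
    by (subst p) (simp add: higher_pderiv_sum[of 1, simplified] pderiv_smult del: pderiv_monom)
  moreover have "[:0, 1:] * p = (\<Sum>i\<le>degree p. smult (coeff p i) ([:0, 1:] * monom 1 i))"
    by (subst p) (simp only: sum_distrib_left mult_smult_right)
  ultimately show ?thesis
    by (simp only: sum gauss_int_smult monom sum_distrib_left mult.left_commute)
qed

text \<open>For the Gaussian pairing, the adjoint of d/dx is twice the raising operator.\<close>

lemma gauss_int_hermite_Suc: "gauss_int (p * hermite (Suc n)) = gauss_int (pderiv p * hermite n) / 2"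
proof -
  define C where "C = gauss_int ([:0, 1:] * (p * hermite n))"
  have "2 * C = gauss_int (p * pderiv (hermite n)) + gauss_int (pderiv p * hermite n)"
    unfolding C_def gauss_int_pderiv[symmetric] pderiv_mult gauss_int_add by (simp add: mult.commute)
  moreover have "p * hermite (Suc n) = [:0, 1:] * (p * hermite n) - smult (1/2) (p * pderiv (hermite n))"
    by (simp add: algebra_simps)
  then have "gauss_int (p * hermite (Suc n)) = C - gauss_int (p * pderiv (hermite n)) / 2"
    by (simp only: gauss_int_diff gauss_int_smult C_def) simp
  ultimately show ?thesis
    by (simp add: field_simps del: hermite.simps)
qed

lemma gauss_int_hermite_mult_pderiv:
  "gauss_int (hermite n * pderiv (hermite m)) = 2 * gauss_int (hermite (Suc n) * hermite m)"
  using gauss_int_hermite_Suc[of "hermite m" n] by (simp add: mult.commute del: hermite.simps)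

lemma gauss_int_hermite_Suc_Suc:
  "gauss_int (hermite (Suc n) * hermite (Suc m)) = of_nat (Suc n) / 2 * gauss_int (hermite n * hermite m)"
  by (simp add: gauss_int_hermite_Suc pderiv_hermite_Suc gauss_int_smult del: hermite.simps of_nat_Suc)

lemma gauss_int_pderiv_hermite:
  "gauss_int (pderiv (hermite n) * pderiv (hermite m)) = 2 * of_nat n * gauss_int (hermite n * hermite m)"
proof (cases n)
  case (Suc k)
  have "gauss_int (pderiv (hermite n) * pderiv (hermite m)) =
      of_nat n * gauss_int (hermite k * pderiv (hermite m))"
    by (simp add: Suc pderiv_hermite_Suc gauss_int_smult del: hermite.simps of_nat_Suc)
  then show ?thesis
    by (simp add: gauss_int_hermite_mult_pderiv Suc del: hermite.simps of_nat_Suc)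
qed (simp add: pderiv_1)

text \<open>Lowering both indices together leads to a pairing with index 0, where the derivative of
  1 makes it vanish unless both indices are 0. The equivalence also provides nonzero norms.\<close>

lemma gauss_int_hermite: "gauss_int (hermite n * hermite m) = 0 \<longleftrightarrow> n \<noteq> m"
proof (induction n arbitrary: m)
  case 0
  show ?case
  proof (cases m)
    case 0
    then show ?thesis using gauss_int_monom[of 0] by simp
  next
    case (Suc k)
    then show ?thesis
      using gauss_int_hermite_Suc[of 1 k] by (simp del: hermite.simps(2))
  qed
next
  case (Suc n)
  show ?case
  proof (cases m)
    case 0
    then show ?thesis
      using gauss_int_hermite_Suc[of 1 n] by (simp del: hermite.simps(2))
  next
    case (Suc k)
    have "of_nat (Suc n) / 2 \<noteq> (0 :: complex)" by (simp del: of_nat_Suc)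
    then show ?thesis
      using Suc.IH[of k] by (simp add: Suc gauss_int_hermite_Suc_Suc del: hermite.simps of_nat_Suc)
  qed
qed

subsection \<open>The orthogonal polynomials of the weight\<close>

lemma mat2_nth [simp]:
  "mat2 p q r s $ 1 $ 1 = p" "mat2 p q r s $ 1 $ 2 = q"
  "mat2 p q r s $ 2 $ 1 = r" "mat2 p q r s $ 2 $ 2 = s"
  by (simp_all add: mat2_def)

lemma mat2_eq_iff:
  "A = B \<longleftrightarrow> A $ 1 $ 1 = B $ 1 $ 1 \<and> A $ 1 $ 2 = B $ 1 $ 2 \<and> A $ 2 $ 1 = B $ 2 $ 1 \<and> A $ 2 $ 2 = B $ 2 $ 2"
  for A B :: "'a ^ 2 ^ 2"
  by (auto simp: vec_eq_iff forall_2)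

lemma matrix_mult_nth_2: "(A ** B) $ i $ j = A $ i $ 1 * B $ 1 $ j + A $ i $ 2 * B $ 2 $ j"
  for A B :: "'a::comm_ring_1 ^ 2 ^ 2"
  by (simp add: matrix_matrix_mult_def sum_2)

definition nu :: "real \<Rightarrow> nat \<Rightarrow> complex" where
  "nu a n = of_nat n + 2 / (of_real a)\<^sup>2"

text \<open>The rows are chosen so that multiplying by \<open>weight_root\<close> leaves a multiple
  of one Hermite polynomial or derivative in each entry; the factors 1/\<nu> make the second row
  monic.\<close>

definition ortho_mp :: "real \<Rightarrow> nat \<Rightarrow> 2 matpoly" where
  "ortho_mp a n = (let h = hermite n; h' = pderiv h in
     mat2 h (smult (- of_real a / 2) h')
          (smult (- 1 / (of_real a * nu a n)) h')
          (smult (2 / ((of_real a)\<^sup>2 * nu a n)) h + smult (1 / nu a n) ([:0, 1:] * h')))"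

text \<open>The weight is exp(-x^2) times this matrix times its conjugate transpose, which reduces
  matrix pairings to scalar Gaussian ones.\<close>

definition weight_root :: "real \<Rightarrow> 2 matpoly" where
  "weight_root a = mat2 1 [:0, of_real a:] 0 1"

lemma nu_Suc: "nu a (Suc n) = nu a n + 1"
  by (simp add: nu_def)

lemma nu_nonzero:
  assumes "a \<noteq> 0"
  shows "nu a n \<noteq> 0"
proof -
  have "nu a n = of_real (real n + 2 / a\<^sup>2)" by (simp add: nu_def)
  moreover have "real n + 2 / a\<^sup>2 > 0" using assms by (simp add: add_nonneg_pos)
  ultimately show ?thesis by (metis less_irrefl of_real_eq_0_iff)
qed

lemma mp_monic_ortho_mp:
  assumes "a \<noteq> 0"
  shows "mp_monic n (ortho_mp a n)"
proof -
  note nz = nu_nonzero[OF assms, of n]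
  have "mp_coeff (ortho_mp a n) k = (if k = n then mat 1 else 0)" if "k \<ge> n" for k
  proof (cases "k = n")
    case True
    \<comment> \<open>The leading coefficient of the lower right entry; \<nu> = n + 2/a^2 is exactly
      the normalisation that makes it 1.\<close>
    have "2 / ((of_real a)\<^sup>2 * nu a n) + 1 / nu a n * of_nat n = 1"
      using nz assms by (simp add: field_simps) (simp add: nu_def field_simps)
    then show ?thesis
      using True by (cases n) (simp_all add: mat2_eq_iff ortho_mp_def Let_def mp_coeff_def mat_def
          coeff_hermite coeff_pderiv pderiv_1 del: hermite.simps(2))
  next
    case False
    with that show ?thesis
      by (cases k) (simp_all add: mat2_eq_iff ortho_mp_def Let_def mp_coeff_def
          coeff_hermite coeff_pderiv del: hermite.simps(2))
  qed
  then show ?thesis by (simp add: mp_monic_def)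
qed

text \<open>The denominator in the lower left entry is the pole at \<nu> = 0 from which all
  conditions on the eigenvalues arise.\<close>

lemma ortho_mp_subleading:
  assumes "a \<noteq> 0"
  shows "mp_coeff (ortho_mp a (Suc n)) n = mat2 0 (- of_real a / 2 * of_nat (Suc n))
            (- of_nat (Suc n) / (of_real a * nu a (Suc n))) 0"
proof -
  have "coeff ([:0, 1:] * pderiv (hermite (Suc n))) n = 0"
    by (cases n) (simp_all add: coeff_pderiv coeff_hermite del: hermite.simps(2))
  then show ?thesis
    by (simp add: mat2_eq_iff ortho_mp_def Let_def mp_coeff_def coeff_hermite coeff_pderiv
        del: hermite.simps(2) mult_pCons_left of_nat_Suc)
qed

text \<open>The Hermite recursion collapses the upper right entry, and in the lower right entry the
  two terms in x h' cancel.\<close>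

lemma ortho_mp_weight_root:
  assumes "a \<noteq> 0"
  shows "ortho_mp a n ** weight_root a = mat2 (hermite n) (smult (of_real a) (hermite (Suc n)))
           (smult (- 1 / (of_real a * nu a n)) (pderiv (hermite n)))
           (smult (2 / ((of_real a)\<^sup>2 * nu a n)) (hermite n))"
  using assms nu_nonzero[OF assms, of n]
  by (simp add: mat2_eq_iff matrix_mult_nth_2 ortho_mp_def weight_root_def Let_def smult_diff_right
      del: mult_pCons_left) (simp add: smult_diff_right)

section \<open>Inner products, orthogonality and uniqueness\<close>

lemma mp_inner_W_ex:
  assumes "\<And>i j x. poly (Q $ i $ j) (complex_of_real x) \<in> \<real>"
  shows "mp_inner UNIV (W_ex a) P Q =
    (\<chi> i j. gauss_int (((P ** weight_root a) ** transpose (Q ** weight_root a)) $ i $ j))"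
proof -
  have cnj: "cnj (poly (Q $ i $ j) (complex_of_real x)) = poly (Q $ i $ j) (complex_of_real x)" for i j x
    using assms by (simp add: Reals_cnj_iff)
  have "(mp_eval P x ** W_ex a x ** ctranspose (mp_eval Q x)) $ i $ j = exp (- x\<^sup>2) *\<^sub>R
      poly (((P ** weight_root a) ** transpose (Q ** weight_root a)) $ i $ j) (of_real x)" for i j x
    by (simp add: matrix_mult_nth_2 transpose_def ctranspose_def mp_eval_def W_ex_def weight_root_def
        cnj) (simp add: scaleR_conv_of_real algebra_simps power2_eq_square)
  then show ?thesis
    by (simp add: mp_inner_def gauss_int_def set_lebesgue_integral_def)
qed

lemma ortho_mp_real: "poly (ortho_mp a n $ i $ j) (complex_of_real x) \<in> \<real>"
proof -
  have "nu a n = of_real (real n + 2 / a\<^sup>2)" by (simp add: nu_def)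
  then have "nu a n \<in> \<real>" by (metis Reals_of_real)
  then have "\<forall>i j. poly (ortho_mp a n $ i $ j) (complex_of_real x) \<in> \<real>"
    by (auto simp: forall_2 ortho_mp_def Let_def poly_hermite_real poly_pderiv_hermite_real
        intro!: Reals_add Reals_mult Reals_divide Reals_power Reals_minus)
  then show ?thesis by blast
qed

lemma mp_inner_ortho_mp:
  "mp_inner UNIV (W_ex a) P (ortho_mp a m) = (\<chi> i j. gauss_int
     (((P ** weight_root a) ** transpose (ortho_mp a m ** weight_root a)) $ i $ j))"
  by (rule mp_inner_W_ex) (rule ortho_mp_real)

lemma mp_inner_ortho_mp_add:
  "mp_inner UNIV (W_ex a) (P + Q) (ortho_mp a m) =
     mp_inner UNIV (W_ex a) P (ortho_mp a m) + mp_inner UNIV (W_ex a) Q (ortho_mp a m)"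
  by (simp add: mp_inner_ortho_mp matrix_mult_add_left gauss_int_add vec_eq_iff)

lemma mp_inner_ortho_mp_const:
  "mp_inner UNIV (W_ex a) (mp_const C ** P) (ortho_mp a m) = C ** mp_inner UNIV (W_ex a) P (ortho_mp a m)"
  by (simp add: mp_inner_ortho_mp mp_const_def vec_eq_iff matrix_mult_nth_2[where 'a=complex]
      gauss_int_smult gauss_int_add matrix_mult_nth_2[where A="\<chi> i j. [:C $ i $ j:]"]
      flip: matrix_mul_assoc)

text \<open>Off the diagonal, pairing with h' is twice pairing with the other index raised, and the
  terms cancel. On it, 1 + a^2 (n+1)/2 and 2n + 4/a^2 combine to multiples of \<nu> at n + 1 and at
  n.\<close>

lemma mp_inner_ortho_mp_ortho_mp:
  assumes "a \<noteq> 0"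
  shows "mp_inner UNIV (W_ex a) (ortho_mp a n) (ortho_mp a m) =
    mat2 ((of_real a)\<^sup>2 / 2 * nu a (Suc n) * gauss_int (hermite n * hermite m)) 0
         0 (2 / ((of_real a)\<^sup>2 * nu a m) * gauss_int (hermite n * hermite m))"
proof -
  have J: "gauss_int (pderiv (hermite n) * hermite m) = 2 * gauss_int (hermite n * hermite (Suc m))"
    using gauss_int_hermite_mult_pderiv[of m n] by (simp add: mult.commute del: hermite.simps)
  have N: "of_nat n = nu a n - 2 / (of_real a)\<^sup>2"
    by (simp add: nu_def)
  show ?thesis
    unfolding mp_inner_ortho_mp ortho_mp_weight_root[OF assms]
    using assms nu_nonzero[OF assms, of n] nu_nonzero[OF assms, of m]
    by (auto simp: mat2_eq_iff matrix_mult_nth_2 transpose_def gauss_int_add gauss_int_smult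
        gauss_int_minus J gauss_int_hermite_Suc_Suc gauss_int_pderiv_hermite
        gauss_int_hermite_mult_pderiv nu_Suc N divide_simps simp del: hermite.simps)
      (simp_all add: algebra_simps power2_eq_square)
qed

lemma mp_inner_ortho_mp_lower:
  assumes a: "a \<noteq> 0" and "\<forall>k\<ge>m. mp_coeff Q k = 0"
  shows "mp_inner UNIV (W_ex a) Q (ortho_mp a m) = 0"
  using mp_monic_ortho_mp[OF a] assms(2)
proof (induction rule: mp_monic_induct)
  case zero
  show ?case by (simp add: mp_inner_ortho_mp vec_eq_iff)
next
  case (step l C Q)
  then have "mp_inner UNIV (W_ex a) (ortho_mp a l) (ortho_mp a m) = 0"
    using gauss_int_hermite[of l m] by (simp add: mp_inner_ortho_mp_ortho_mp[OF a] mat2_eq_iff)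
  with step show ?case
    by (simp add: mp_inner_ortho_mp_add mp_inner_ortho_mp_const matrix_mult_0_right)
qed

text \<open>Pairing with the highest \<open>ortho_mp a m\<close> that occurs isolates its
  coefficient, and the norm of \<open>ortho_mp a m\<close> is an invertible diagonal matrix.\<close>

lemma mp_eq_0_if_orthogonal:
  assumes a: "a \<noteq> 0" and "\<forall>k\<ge>n. mp_coeff Q k = 0"
    and "\<forall>m<n. mp_inner UNIV (W_ex a) Q (ortho_mp a m) = 0"
  shows "Q = 0"
proof -
  have "(\<forall>m<n. mp_inner UNIV (W_ex a) Q (ortho_mp a m) = 0) \<longrightarrow> Q = 0"
    using mp_monic_ortho_mp[OF a] assms(2)
  proof (induction rule: mp_monic_induct)
    case (step m C Q)
    show ?case
    proof
      assume *: "\<forall>l<n. mp_inner UNIV (W_ex a) (mp_const C ** ortho_mp a m + Q) (ortho_mp a l) = 0"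
      define d where "d = gauss_int (hermite m * hermite m)"
      have nz: "d \<noteq> 0" "nu a m \<noteq> 0" "nu a (Suc m) \<noteq> 0"
        using gauss_int_hermite[of m m] nu_nonzero[OF a] by (auto simp: d_def)
      have "0 = C ** mp_inner UNIV (W_ex a) (ortho_mp a m) (ortho_mp a m)"
        using *[rule_format, of m] step mp_inner_ortho_mp_lower[OF a step(2)]
        by (simp add: mp_inner_ortho_mp_add mp_inner_ortho_mp_const)
      then have "C = 0"
        using nz a by (simp add: mp_inner_ortho_mp_ortho_mp[OF a] mat2_eq_iff matrix_mult_nth_2 d_def)
      with * step show "mp_const C ** ortho_mp a m + Q = 0"
        by simp
    qed
  qed simp
  then show ?thesis using assms(3) by blast
qed

lemma monic_ortho_W_ex:
  assumes a: "a \<noteq> 0"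
  shows "monic_ortho UNIV (W_ex a) = ortho_mp a"
  unfolding monic_ortho_def
proof (rule the_equality)
  show "is_monic_ortho UNIV (W_ex a) (ortho_mp a)"
    using gauss_int_hermite
    by (auto simp: is_monic_ortho_def mp_monic_ortho_mp[OF a] mp_inner_ortho_mp_ortho_mp[OF a] mat2_eq_iff)
next
  fix P assume P: "is_monic_ortho UNIV (W_ex a) P"
  have "P n = ortho_mp a n" for n
  proof (induction n rule: less_induct)
    case (less n)
    have "mp_coeff (P n - ortho_mp a n) k = 0" if "k \<ge> n" for k
      using P mp_monic_ortho_mp[OF a, of n] that
      by (cases "k = n") (auto simp: is_monic_ortho_def mp_monic_def mp_coeff_diff)
    moreover have "mp_inner UNIV (W_ex a) (P n - ortho_mp a n) (ortho_mp a m) = 0" if "m < n" for m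
    proof -
      \<comment> \<open>The induction hypothesis identifies \<open>ortho_mp a m\<close> with
        \<open>P m\<close>, so the orthogonality of the sequence \<open>P\<close> applies.\<close>
      have "mp_inner UNIV (W_ex a) (P n) (ortho_mp a m) = 0"
        using P less that unfolding is_monic_ortho_def by (metis less_irrefl)
      moreover have "mp_inner UNIV (W_ex a) (ortho_mp a n) (ortho_mp a m) = 0"
        using gauss_int_hermite[of n m] that by (simp add: mp_inner_ortho_mp_ortho_mp[OF a] mat2_eq_iff)
      ultimately show ?thesis
        using mp_inner_ortho_mp_add[of a "P n - ortho_mp a n" "ortho_mp a n" m] by simp
    qed
    ultimately show ?case
      using mp_eq_0_if_orthogonal[OF a, of n "P n - ortho_mp a n"] by simp
  qed
  then show "P = ortho_mp a" by auto
qed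

subsection \<open>Eigenvalues of the generators\<close>

lemma diffop_act_quadratic:
  "diffop_act P [:F0, F1, F2:] = P ** F0 + mp_deriv P ** F1 + mp_deriv (mp_deriv P) ** F2"
  by (subst diffop_act_bound[of _ 2]) (simp_all add: eval_nat_numeral ac_simps)

text \<open>Hermite's equation reduces higher derivatives to h and h'. With n written through \<nu>,
  each entry becomes a rational identity in x, h, h', a and \<nu>.\<close>

lemma diffop_act_D5_ex:
  assumes "a \<noteq> 0"
  shows "diffop_act (ortho_mp a n) (D5_ex a) =
    mp_const (mat2 (- 2 * (nu a n + 1)) 0 0 (- 2 * nu a n)) ** ortho_mp a n"
proof -
  define A where "A = complex_of_real a"
  define N :: complex where "N = of_nat n"
  define v where "v = nu a n"
  define h where "h = hermite n"
  define h1 where "h1 = pderiv h"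
  have d2: "pderiv h1 = [:0, 2:] * h1 - smult (2 * N) h"
    unfolding h1_def h_def N_def by (rule pderiv_pderiv_hermite)
  have nz: "A \<noteq> 0" "v \<noteq> 0"
    using assms nu_nonzero[OF assms] by (simp_all add: A_def v_def)
  have N: "N = v - 2 / A\<^sup>2"
    by (simp add: v_def nu_def N_def A_def)
  show ?thesis
    unfolding D5_ex_def Let_def diffop_act_quadratic ortho_mp_def A_def[symmetric] v_def[symmetric] h_def[symmetric] h1_def[symmetric]
    using nz
    by (simp add: mat2_eq_iff matrix_mult_nth_2 mp_deriv_def mp_const_def mat_def
       pderiv_add pderiv_smult pderiv_mult pderiv_diff pderiv_minus pderiv_pCons d2 h1_def[symmetric],
       auto simp: poly_eq_poly_eq_iff[symmetric] fun_eq_iff N, simp_all add: divide_simps) algebra+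
qed

text \<open>The check again reduces to h and h'. The antidiagonal eigenvalue means that the operator
  exchanges the two rows up to scalars.\<close>

lemma diffop_act_D1_ex:
  assumes "a \<noteq> 0"
  shows "diffop_act (ortho_mp a n) (D1_ex a) =
    mp_const (mat2 0 ((of_real a)\<^sup>2 * nu a n * (nu a n + 1)) (4 / (of_real a)\<^sup>2) 0) ** ortho_mp a n"
proof -
  define A where "A = complex_of_real a"
  define N :: complex where "N = of_nat n"
  define v where "v = nu a n"
  define h where "h = hermite n"
  define h1 where "h1 = pderiv h"
  have d2: "pderiv h1 = [:0, 2:] * h1 - smult (2 * N) h"
    unfolding h1_def h_def N_def by (rule pderiv_pderiv_hermite)
  have nz: "A \<noteq> 0" "v \<noteq> 0"
    using assms nu_nonzero[OF assms] by (simp_all add: A_def v_def)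
  have N: "N = v - 2 / A\<^sup>2"
    by (simp add: v_def nu_def N_def A_def)
  show ?thesis
    unfolding D1_ex_def Let_def diffop_act_quadratic ortho_mp_def A_def[symmetric] v_def[symmetric] h_def[symmetric] h1_def[symmetric]
    using nz
    by (simp add: mat2_eq_iff matrix_mult_nth_2 mp_deriv_def mp_const_def mat_def
       pderiv_add pderiv_smult pderiv_mult pderiv_diff pderiv_minus pderiv_pCons d2 h1_def[symmetric],
       auto simp: poly_eq_poly_eq_iff[symmetric] fun_eq_iff N, simp_all add: divide_simps) algebra+
qed

subsection \<open>Eigenvalue sequences of the generated algebra\<close>

text \<open>Passing to the realised sequences replaces operator computations by pointwise matrix
  algebra.\<close>

definition eigenvalue_alg ::
  "(nat \<Rightarrow> 'n::finite matpoly) \<Rightarrow> 'n diffop set \<Rightarrow> (nat \<Rightarrow> complex ^ 'n ^ 'n) set"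
where
  "eigenvalue_alg P G =
     {L. \<exists>D\<in>diffop_alg G. \<forall>n. diffop_act (P n) D = mp_const (L n) ** P n}"

text \<open>Constants on the left commute with the action on the right, so the order of the factors
  is preserved.\<close>

lemma eigenvalue_alg_mult:
  assumes "L \<in> eigenvalue_alg P G" "M \<in> eigenvalue_alg P G"
  shows "(\<lambda>n. L n ** M n) \<in> eigenvalue_alg P G"
proof -
  obtain D E where "D \<in> diffop_alg G" "\<And>n. diffop_act (P n) D = mp_const (L n) ** P n"
    "E \<in> diffop_alg G" "\<And>n. diffop_act (P n) E = mp_const (M n) ** P n"
    using assms unfolding eigenvalue_alg_def by blast
  then have "diffop_mult D E \<in> diffop_alg G"
    "\<And>n. diffop_act (P n) (diffop_mult D E) = mp_const (L n ** M n) ** P n"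
    by (auto intro: diffop_alg.mult
        simp: diffop_act_mult diffop_act_const_left mp_const_mult matrix_mul_assoc)
  then show ?thesis unfolding eigenvalue_alg_def by blast
qed

lemma eigenvalue_alg_add:
  assumes "L \<in> eigenvalue_alg P G" "M \<in> eigenvalue_alg P G"
  shows "(\<lambda>n. L n + M n) \<in> eigenvalue_alg P G"
proof -
  obtain D E where "D \<in> diffop_alg G" "\<And>n. diffop_act (P n) D = mp_const (L n) ** P n"
    "E \<in> diffop_alg G" "\<And>n. diffop_act (P n) E = mp_const (M n) ** P n"
    using assms unfolding eigenvalue_alg_def by blast
  then have "D + E \<in> diffop_alg G"
    "\<And>n. diffop_act (P n) (D + E) = mp_const (L n + M n) ** P n"
    by (auto intro: diffop_alg.add simp: diffop_act_add mp_const_add matrix_mult_add_left)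
  then show ?thesis unfolding eigenvalue_alg_def by blast
qed

lemma eigenvalue_alg_scale:
  assumes "L \<in> eigenvalue_alg P G"
  shows "(\<lambda>n. mat c ** L n) \<in> eigenvalue_alg P G"
proof -
  obtain D where "D \<in> diffop_alg G" "\<And>n. diffop_act (P n) D = mp_const (L n) ** P n"
    using assms unfolding eigenvalue_alg_def by blast
  then have "diffop_scale c D \<in> diffop_alg G"
    "\<And>n. diffop_act (P n) (diffop_scale c D) = mp_const (mat c ** L n) ** P n"
    by (auto intro: diffop_alg.scale simp: diffop_act_scale mp_const_mult matrix_mul_assoc)
  then show ?thesis unfolding eigenvalue_alg_def by blast
qed

lemma eigenvalue_alg_one:
  assumes "diffop_one \<in> G"
  shows "(\<lambda>n. mat 1) \<in> eigenvalue_alg P G"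
proof -
  have "diffop_act (P n) diffop_one = mp_const (mat 1) ** P n" for n
    by (simp add: diffop_act_one mp_const_mat flip: one_pCons)
  then show ?thesis
    using assms diffop_alg.base[of diffop_one G] unfolding eigenvalue_alg_def by blast
qed

lemma eigenvalue_alg_base:
  assumes "D \<in> G" "\<And>n. diffop_act (P n) D = mp_const (L n) ** P n"
  shows "L \<in> eigenvalue_alg P G"
  using assms diffop_alg.base[of D G] unfolding eigenvalue_alg_def by blast

lemma diffop_alg_subset_diffop_algebra_of:
  assumes "G \<subseteq> diffop_algebra_of S W"
  shows "diffop_alg G \<subseteq> diffop_algebra_of S W"
proof
  fix D assume "D \<in> diffop_alg G"
  then show "D \<in> diffop_algebra_of S W"
  proof induction
    case (base D)
    then show ?case using assms by blast
  next
    case zero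
    have "diffop_act (monic_ortho S W n) 0 = mp_const 0 ** monic_ortho S W n" for n
      by simp
    then show ?case unfolding diffop_algebra_of_def by blast
  next
    case (add D E)
    show ?case
      unfolding diffop_algebra_of_def
    proof (intro CollectI allI)
      fix n
      obtain L M where "diffop_act (monic_ortho S W n) D = mp_const L ** monic_ortho S W n"
        "diffop_act (monic_ortho S W n) E = mp_const M ** monic_ortho S W n"
        using add unfolding diffop_algebra_of_def by blast
      then show "\<exists>L. diffop_act (monic_ortho S W n) (D + E) = mp_const L ** monic_ortho S W n"
        by (intro exI[of _ "L + M"]) (simp add: diffop_act_add mp_const_add matrix_mult_add_left)
    qed
  next
    case (scale D c)
    show ?case
      unfolding diffop_algebra_of_def
    proof (intro CollectI allI)
      fix n
      obtain L where "diffop_act (monic_ortho S W n) D = mp_const L ** monic_ortho S W n"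
        using scale unfolding diffop_algebra_of_def by blast
      then show "\<exists>L. diffop_act (monic_ortho S W n) (diffop_scale c D) = mp_const L ** monic_ortho S W n"
        by (intro exI[of _ "mat c ** L"]) (simp add: diffop_act_scale mp_const_mult matrix_mul_assoc)
    qed
  next
    case (mult D E)
    show ?case
      unfolding diffop_algebra_of_def
    proof (intro CollectI allI)
      fix n
      obtain L M where "diffop_act (monic_ortho S W n) D = mp_const L ** monic_ortho S W n"
        "diffop_act (monic_ortho S W n) E = mp_const M ** monic_ortho S W n"
        using mult unfolding diffop_algebra_of_def by blast
      then show "\<exists>L. diffop_act (monic_ortho S W n) (diffop_mult D E) = mp_const L ** monic_ortho S W n"
        by (intro exI[of _ "L ** M"])
          (simp add: diffop_act_mult diffop_act_const_left mp_const_mult matrix_mul_assoc)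
    qed
  qed
qed

text \<open>
  The conditions on the entries come from the pole of the subleading coefficient of \<open>P\<^sub>n\<close> at
  \<open>\<nu> = 0\<close>, where \<open>\<nu> = n + 2/a\<^sup>2\<close>, while the coefficients of the operator contribute only polynomials.
\<close>

lemma eigenvalues_poly:
  assumes a: "a \<noteq> 0"
    and eig: "\<And>n. diffop_act (ortho_mp a n) D = mp_const (L n) ** ortho_mp a n"
  obtains f11 f12 f21 f22 where
    "\<And>n. L n = mat2 (poly f11 (nu a n)) (poly f12 (nu a n)) (poly f21 (nu a n)) (poly f22 (nu a n))"
    "poly f12 0 = 0" "poly f12 (- 1) = 0" "poly f22 0 = poly f11 (- 1)"
proof -
  define A where "A = complex_of_real a"
  define c where "c = 2 / A\<^sup>2"
  have nz: "A \<noteq> 0" using a by (simp add: A_def)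
  have nu: "nu a n = of_nat n + c" for n
    by (simp add: nu_def c_def A_def)
  note monic = mp_monic_ortho_mp[OF a]
  have "\<exists>p. \<forall>n. L n $ r $ s = poly p (nu a n)" for r s
    using coeff_diffop_act_monom_poly[of 0 D r s c] eigenvalue_eq_coeff[OF monic eig] by (simp add: nu)
  then obtain f where f: "\<And>r s n. L n $ r $ s = poly (f r s) (nu a n)"
    by metis
  define M where "M n = mp_coeff (diffop_act (mat (monom 1 (Suc n))) D) n" for n
  have "\<exists>p. \<forall>n. M n $ r $ s = poly p (nu a (Suc n))" for r s
  proof -
    obtain p where p: "\<And>n. n \<ge> 1 \<Longrightarrow>
        mp_coeff (diffop_act (mat (monom 1 n)) D) (n - 1) $ r $ s = poly p (of_nat n + c)"
      using coeff_diffop_act_monom_poly[of 1 D r s c] by blast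
    have "M n $ r $ s = poly p (nu a (Suc n))" for n
      using p[of "Suc n"] by (simp add: M_def nu)
    then show ?thesis by blast
  qed
  then obtain m where m: "\<And>r s n. M n $ r $ s = poly (m r s) (nu a (Suc n))"
    by metis
  define B where "B n = mp_coeff (ortho_mp a (Suc n)) n" for n
  have B: "B n $ 1 $ 1 = 0" "B n $ 1 $ 2 = - A / 2 * (nu a (Suc n) - c)"
    "B n $ 2 $ 1 = - (nu a (Suc n) - c) / (A * nu a (Suc n))" "B n $ 2 $ 2 = 0" for n
    unfolding B_def ortho_mp_subleading[OF a] by (simp_all add: nu A_def)
  have sub: "(L (Suc n) ** B n) $ r $ s = M n $ r $ s + (B n ** L n) $ r $ s" for n r s
    using eigenvalue_subleading[OF monic eig, of n] by (simp add: B_def M_def)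
  have nu_pred: "nu a n = nu a (Suc n) - 1" for n
    by (simp add: nu)
  let ?x = "[:0, 1:] :: complex poly" and ?x1 = "[:- 1, 1:] :: complex poly"
  have eq0: "p = q \<Longrightarrow> poly p 0 = poly q 0" for p q :: "complex poly" by simp
  have nu': "of_nat (Suc n) + c = nu a (Suc n)" for n by (simp add: nu)
  have shift: "poly (f r s) (nu a n) = poly (pcompose (f r s) ?x1) (nu a (Suc n))" for r s n
    by (simp add: poly_pcompose nu_pred[of n])
  have nzn: "nu a (Suc n) \<noteq> 0" for n by (rule nu_nonzero[OF a])
  \<comment> \<open>In entry (1,1) the pole of \<open>B n\<close> meets \<open>f 1 2\<close>.
    Multiplying by A \<nu> clears it, and at \<nu> = 0 only the former polar term survives.\<close>
  have "smult A (?x * m 1 1) =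
      [:A\<^sup>2 / 2:] * ([:- c, 1:] * ?x * pcompose (f 2 1) ?x1) - [:- c, 1:] * f 1 2"
  proof (rule poly_eq_of_nat_shift)
    fix n
    show "poly (smult A (?x * m 1 1)) (of_nat (Suc n) + c) = poly ([:A\<^sup>2 / 2:] * ([:- c, 1:] * ?x *
        pcompose (f 2 1) ?x1) - [:- c, 1:] * f 1 2) (of_nat (Suc n) + c)"
      using sub[of n 1 1] nzn[of n] nz unfolding nu'
      by (simp add: matrix_mult_nth_2 B f m shift divide_simps) algebra
  qed
  from eq0[OF this] have f12: "c * poly (f 1 2) 0 = 0" by simp
  \<comment> \<open>In entry (2,1) the pole multiplies both \<open>f 2 2\<close> at \<nu> and
    \<open>f 1 1\<close> at \<nu> - 1, which ties their values at 0 and -1.\<close>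
  have "smult A (?x * m 2 1) = [:- c, 1:] * (pcompose (f 1 1) ?x1 - f 2 2)"
  proof (rule poly_eq_of_nat_shift)
    fix n
    show "poly (smult A (?x * m 2 1)) (of_nat (Suc n) + c) =
        poly ([:- c, 1:] * (pcompose (f 1 1) ?x1 - f 2 2)) (of_nat (Suc n) + c)"
      using sub[of n 2 1] nzn[of n] nz unfolding nu'
      by (simp add: matrix_mult_nth_2 B f m shift divide_simps) algebra
  qed
  from eq0[OF this] have f22: "c * (poly (f 1 1) (- 1) - poly (f 2 2) 0) = 0"
    by (simp add: poly_pcompose)
  \<comment> \<open>In entry (2,2) the pole meets \<open>f 1 2\<close> at \<nu> - 1, hence the zero
    at -1.\<close>
  have "smult A (?x * m 2 2) =
      [:- c, 1:] * pcompose (f 1 2) ?x1 - [:A\<^sup>2 / 2:] * ([:- c, 1:] * ?x * f 2 1)"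
  proof (rule poly_eq_of_nat_shift)
    fix n
    show "poly (smult A (?x * m 2 2)) (of_nat (Suc n) + c) = poly ([:- c, 1:] * pcompose (f 1 2) ?x1
        - [:A\<^sup>2 / 2:] * ([:- c, 1:] * ?x * f 2 1)) (of_nat (Suc n) + c)"
      using sub[of n 2 2] nzn[of n] nz unfolding nu'
      by (simp add: matrix_mult_nth_2 B f m shift divide_simps) algebra
  qed
  from eq0[OF this] have f12': "c * poly (f 1 2) (- 1) = 0"
    by (simp add: poly_pcompose)
  have "c \<noteq> 0" using nz by (simp add: c_def)
  show ?thesis
  proof (rule that)
    show "L n = mat2 (poly (f 1 1) (nu a n)) (poly (f 1 2) (nu a n)) (poly (f 2 1) (nu a n))
        (poly (f 2 2) (nu a n))" for n
      by (simp add: mat2_eq_iff f)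
  qed (use f12 f22 f12' \<open>c \<noteq> 0\<close> in auto)
qed

text \<open>An admissible sequence splits into a polynomial in N = diag(\<nu> + 1, \<nu>), an upper
  right part divisible by \<nu>(\<nu> + 1), an arbitrary lower left part, and an upper left part
  divisible by \<nu> + 1; each is realised separately.\<close>

lemma eigenvalue_alg_generators:
  fixes a :: real
  defines "R \<equiv> eigenvalue_alg (ortho_mp a) {diffop_one, D1_ex a, D5_ex a}"
  assumes a: "a \<noteq> 0"
    and f12: "poly f12 0 = 0" "poly f12 (- 1) = 0" and f22: "poly f22 0 = poly f11 (- 1)"
  shows "(\<lambda>n. mat2 (poly f11 (nu a n)) (poly f12 (nu a n)) (poly f21 (nu a n)) (poly f22 (nu a n))) \<in> R"
proof -
  define v where "v = nu a"
  define A where "A = complex_of_real a"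
  have A: "A \<noteq> 0" using a by (simp add: A_def)
  have add: "(\<lambda>n. L n + M n) \<in> R" if "L \<in> R" "M \<in> R" for L M
    using that eigenvalue_alg_add unfolding R_def by blast
  have mult: "(\<lambda>n. L n ** M n) \<in> R" if "L \<in> R" "M \<in> R" for L M
    using that eigenvalue_alg_mult unfolding R_def by blast
  have scale: "(\<lambda>n. mat c ** L n) \<in> R" if "L \<in> R" for L c
    using that eigenvalue_alg_scale unfolding R_def by blast
  have diff: "(\<lambda>n. L n + mat (- 1) ** M n) \<in> R" if "L \<in> R" "M \<in> R" for L M
    using that add scale by blast
  note ext = mat2_eq_iff matrix_mult_nth_2 mat_def
  have one: "(\<lambda>n. mat 1) \<in> R"
    unfolding R_def by (rule eigenvalue_alg_one) simp
  have D1: "(\<lambda>n. mat2 0 (A\<^sup>2 * v n * (v n + 1)) (4 / A\<^sup>2) 0) \<in> R"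
    unfolding R_def A_def v_def
    by (rule eigenvalue_alg_base[of "D1_ex a"]) (simp_all add: diffop_act_D1_ex[OF a])
  have D5: "(\<lambda>n. mat2 (- 2 * (v n + 1)) 0 0 (- 2 * v n)) \<in> R"
    unfolding R_def v_def
    by (rule eigenvalue_alg_base[of "D5_ex a"]) (simp_all add: diffop_act_D5_ex[OF a])
  have N: "(\<lambda>n. mat2 (v n + 1) 0 0 (v n)) \<in> R"
    using scale[OF D5, of "- 1 / 2"]
    by (rule back_subst[of "\<lambda>L. L \<in> R"]) (simp add: ext fun_eq_iff field_simps)
  have scalar: "(\<lambda>n. mat2 (poly p (v n + 1)) 0 0 (poly p (v n))) \<in> R" for p
  proof (induction p)
    case 0
    show ?case
      using scale[OF one, of 0]
      by (rule back_subst[of "\<lambda>L. L \<in> R"]) (simp add: ext fun_eq_iff)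
  next
    case (pCons c p)
    show ?case
      using add[OF scale[OF one, of c] mult[OF N pCons(2)]]
      by (rule back_subst[of "\<lambda>L. L \<in> R"]) (simp add: ext fun_eq_iff)
  qed
  text \<open>Commutation with \<open>N\<close> separates the raising and lowering parts of \<open>D\<^sub>1\<close>.\<close>
  have comm: "(\<lambda>n. mat2 0 (A\<^sup>2 * v n * (v n + 1)) (- 4 / A\<^sup>2) 0) \<in> R"
    using diff[OF mult[OF N D1] mult[OF D1 N]] A
    by (elim back_subst[of "\<lambda>L. L \<in> R"]) (simp add: ext fun_eq_iff field_simps)
  have X: "(\<lambda>n. mat2 0 (v n * (v n + 1)) 0 0) \<in> R"
    using scale[OF add[OF D1 comm], of "1 / (2 * A\<^sup>2)"] A
    by (elim back_subst[of "\<lambda>L. L \<in> R"]) (simp add: ext fun_eq_iff)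
  have Y: "(\<lambda>n. mat2 0 0 1 0) \<in> R"
    using scale[OF diff[OF D1 comm], of "A\<^sup>2 / 8"] A
    by (elim back_subst[of "\<lambda>L. L \<in> R"]) (simp add: ext fun_eq_iff)
  \<comment> \<open>x(x + 1) evaluated at N is diag((\<nu>+1)(\<nu>+2), \<nu>(\<nu>+1)), whereas XY
    + YX is \<nu>(\<nu>+1) times the identity. They differ by 2(\<nu>+1) in the upper left
    corner.\<close>
  have Z: "(\<lambda>n. mat2 (v n + 1) 0 0 0) \<in> R"
    using scale[OF diff[OF scalar[of "[:0, 1, 1:]"] add[OF mult[OF X Y] mult[OF Y X]]], of "1 / 2"]
    by (rule back_subst[of "\<lambda>L. L \<in> R"]) (simp add: ext fun_eq_iff algebra_simps)
  obtain p where p: "f12 = [:0, 1:] * [:1, 1:] * p"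
  proof -
    obtain q where q: "f12 = [:0, 1:] * q"
      using f12(1) poly_eq_0_iff_dvd[of f12 0] by auto
    then have "poly q (- 1) = 0" using f12(2) by simp
    then obtain p where "q = [:1, 1:] * p"
      using poly_eq_0_iff_dvd[of q "- 1"] by auto
    then show ?thesis using q that by (simp add: mult.assoc)
  qed
  \<comment> \<open>The polynomial \<open>f22\<close> of N already gives the right lower right
    entry; the error in the upper left one vanishes at -1 by \<open>f22\<close>, so it is a multiple
    of the entry of Z.\<close>
  obtain q where q: "f11 - pcompose f22 [:1, 1:] = [:1, 1:] * q"
    using poly_eq_0_iff_dvd[of "f11 - pcompose f22 [:1, 1:]" "- 1"] f22 by (auto simp: poly_pcompose)
  have q': "poly f11 x = poly f22 (x + 1) + (x + 1) * poly q x" for x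
    using arg_cong[OF q, of "\<lambda>p. poly p x"] by (simp add: poly_pcompose algebra_simps)
  have "(\<lambda>n. mat2 0 (poly f12 (v n)) 0 0) \<in> R"
    using mult[OF X scalar[of p]]
    by (rule back_subst[of "\<lambda>L. L \<in> R"]) (simp add: ext fun_eq_iff p algebra_simps)
  \<comment> \<open>The factor on the right enters through its first diagonal entry, taken at \<nu>
    + 1; composing with x - 1 undoes this shift.\<close>
  moreover have "(\<lambda>n. mat2 0 0 (poly f21 (v n)) 0) \<in> R"
    using mult[OF Y scalar[of "pcompose f21 [:- 1, 1:]"]]
    by (rule back_subst[of "\<lambda>L. L \<in> R"]) (simp add: ext fun_eq_iff poly_pcompose)
  moreover have "(\<lambda>n. mat2 ((v n + 1) * poly q (v n)) 0 0 0) \<in> R"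
    using mult[OF Z scalar[of "pcompose q [:- 1, 1:]"]]
    by (rule back_subst[of "\<lambda>L. L \<in> R"]) (simp add: ext fun_eq_iff poly_pcompose)
  ultimately have "(\<lambda>n. mat2 (poly f22 (v n + 1)) 0 0 (poly f22 (v n)) +
      mat2 0 (poly f12 (v n)) 0 0 + mat2 0 0 (poly f21 (v n)) 0 +
      mat2 ((v n + 1) * poly q (v n)) 0 0 0) \<in> R"
    by (intro add scalar)
  then show ?thesis
    by (rule back_subst[of "\<lambda>L. L \<in> R"]) (simp add: ext fun_eq_iff q' v_def)
qed

theorem theorem5p12:
  fixes a :: real
  assumes "a \<noteq> 0"
  shows "diffop_algebra_of UNIV (W_ex a) = diffop_alg {diffop_one, D1_ex a, D5_ex a}"
proof
  let ?G = "{diffop_one, D1_ex a, D5_ex a}"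
  note monic = mp_monic_ortho_mp[OF assms]
  have one: "diffop_act P diffop_one = mp_const (mat 1) ** P" for P :: "2 matpoly"
    by (simp add: diffop_act_one mp_const_mat flip: one_pCons)
  have "?G \<subseteq> diffop_algebra_of UNIV (W_ex a)"
    unfolding diffop_algebra_of_def monic_ortho_W_ex[OF assms]
    using one diffop_act_D1_ex[OF assms] diffop_act_D5_ex[OF assms] by blast
  then show "diffop_alg ?G \<subseteq> diffop_algebra_of UNIV (W_ex a)"
    by (rule diffop_alg_subset_diffop_algebra_of)
  show "diffop_algebra_of UNIV (W_ex a) \<subseteq> diffop_alg ?G"
  proof
    fix D assume "D \<in> diffop_algebra_of UNIV (W_ex a)"
    then obtain L where L: "\<And>n. diffop_act (ortho_mp a n) D = mp_const (L n) ** ortho_mp a n"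
      unfolding diffop_algebra_of_def monic_ortho_W_ex[OF assms] by simp metis
    \<comment> \<open>The eigenvalues of \<open>D\<close> satisfy the three conditions, so some
      \<open>E\<close> in the generated algebra has the same ones; faithfulness then gives
      \<open>D = E\<close>.\<close>
    have "L \<in> eigenvalue_alg (ortho_mp a) ?G"
    proof (rule eigenvalues_poly[OF assms L])
      fix f11 f12 f21 f22
      assume L': "\<And>n. L n = mat2 (poly f11 (nu a n)) (poly f12 (nu a n)) (poly f21 (nu a n)) (poly f22 (nu a n))"
        and "poly f12 0 = 0" "poly f12 (- 1) = 0" "poly f22 0 = poly f11 (- 1)"
      then show ?thesis
        using eigenvalue_alg_generators[OF assms, of f12 f22 f11 f21] by (simp flip: L')
    qed
    then obtain E where E: "E \<in> diffop_alg ?G"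
      and "\<And>n. diffop_act (ortho_mp a n) E = mp_const (L n) ** ortho_mp a n"
      unfolding eigenvalue_alg_def by blast
    then have "D = E"
      using diffop_eqI[OF monic, of D E] L by simp
    then show "D \<in> diffop_alg ?G" using E by simp
  qed
qed

end
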